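(* Let $a,b,z,x_1,\dots,x_n$ be complex parameters with $|z/a^{n-1}|<1$. Suppose that none of the denominators in the following identity vanishes. Then $$\begin{aligned} & \sum_{j_1,\dots,j_n\ge0}\ \prod_{1\leq r<s\leq n}\frac{1-q^{j_{r}-j_{s}}x_{r}/x_{s}}{1-x_{r}/x_{s}}\prod_{r,s=1}^{n}\frac{(ax_{r}/x_{s})_{j_{r}}}{(qx_{r}/x_{s})_{j_{r}}}\cdot\frac{(q)_{|\boldsymbol{j}|}}{(b)_{|\boldsymbol{j}|}}\Big(\frac{z}{a^{n-1}}\Big)^{|\boldsymbol{j}|}q^{\sum_{r=1}^{n}(r-1)j_{r}}\\ &=\sum_{k_1,\dots,k_n\ge0}\ \prod_{1\leq r<s\leq n}\frac{1-q^{k_{r}-k_{s}}x_{r}/x_{s}}{1-x_{r}/x_{s}}\prod_{r,s=1}^{n}\frac{(ax_{r}/x_{s})_{k_{r}}}{(qx_{r}/x_{s})_{k_{r}}}\\ &\quad\times\frac{(1-azq^{2|\boldsymbol{k}|})(q,azq/b)_{|\boldsymbol{k}|}}{(b)_{|\boldsymbol{k}|}(z/a^{n-1})_{|\boldsymbol{k}|+1}}\Big(\frac{bz}{a^{n-1}}\Big)^{|\boldsymbol{k}|}q^{\sum_{r=1}^{n}(r-1)k_{r}+2\binom{|\boldsymbol{k}|}{2}}. \end{aligned}$$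
   Context: $q$ is a complex number with $0<|q|<1$ and $n\ge1$ is an integer. $(z)_k=\prod_{i=0}^{k-1}(1-zq^i)$ for integers $k\ge0$; $(c_1,\dots,c_p)_k=(c_1)_k\cdots(c_p)_k$. Bold letters denote multi-indices of nonnegative integers, $\boldsymbol k=(k_1,\dots,k_n)$, with $|\boldsymbol k|=k_1+\cdots+k_n$. *)

theory Defs
  imports "HOL-Analysis.Analysis"
begin

text \<open>The $q$-shifted factorial $(z)_k = \prod_{i=0}^{k-1} (1 - z q^i)$, with the base \<open>q\<close> explicit.\<close>

definition qpoch :: "complex \<Rightarrow> complex \<Rightarrow> nat \<Rightarrow> complex" where
  "qpoch q z k = (\<Prod>i<k. 1 - z * q ^ i)"

text \<open>A multi-index $(k_1,\dots,k_n)$ is a function that is \<open>undefined\<close> outside \<open>{1..n}\<close>, so that each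
  multi-index is represented exactly once and sums over \<open>multi_indices n\<close> have no repetitions.\<close>

definition multi_indices :: "nat \<Rightarrow> (nat \<Rightarrow> nat) set" where
  "multi_indices n = {1..n} \<rightarrow>\<^sub>E UNIV"

definition weight :: "nat \<Rightarrow> (nat \<Rightarrow> nat) \<Rightarrow> nat" where
  "weight n k = (\<Sum>r=1..n. k r)"

end

(* By Milne's A_n q-binomial theorem the part of either series with |k| = N sums to (a^n)_N / (q)_N
   times a factor that depends on N only. What remains is the Rogers-Fine identity for the numerator
   parameter a^n and the argument z / a^(n-1). Milne's theorem is proved by induction on N: Lagrange
   interpolation at the nodes x_r q^(k_r), used once for raising an index and once for lowering it,
   gives (1 - q^(N+1)) S(N+1) = (1 - a_1 ... a_n q^N) S(N) for the sum S(N) over |k| = N. *)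
theory Submission
  imports Defs
begin

text \<open>Neither multiple series converges visibly, because the factors q^(k_r - k_s) can contain
  negative powers of q. The prefactor q^(sum (r-1) k_r) repairs exactly this: spread over the pairs
  r < s, it turns the double product into a quotient of Vandermonde products in the nodes x_r
  q^(k_r), which stay bounded. The weights are then bounded, both series converge absolutely, and
  this licenses the grouping by |k|. In the induction both interpolations have the same form, with
  parameters c_s q^(k_s) at the nodes of k: c_s = 1 for lowering, c_s = a_s for raising. The term
  that lowers index r of the raised multi-index equals the term that raises index r of the original
  one, so swapping two finite sums matches the two sides. With c_s = 1 the terms that would lower an
  index equal to 0 vanish, which leaves no boundary terms.\<close>

section \<open>Bounds for q-shifted factorials\<close>

lemma qpoch_0 [simp]: "qpoch q c 0 = 1"
  by (simp add: qpoch_def)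

lemma qpoch_Suc: "qpoch q c (Suc k) = qpoch q c k * (1 - c * q ^ k)"
  by (simp add: qpoch_def)

lemma convergent_prod_qpoch:
  assumes "cmod q < 1"
  shows "convergent_prod (\<lambda>i. 1 - c * q ^ i)"
proof -
  have "summable (\<lambda>i. cmod c * cmod q ^ i)"
    using assms by (intro summable_mult summable_geometric) simp
  then show ?thesis
    by (intro abs_convergent_prod_imp_convergent_prod summable_imp_abs_convergent_prod)
      (simp add: norm_mult norm_power)
qed

lemma Bseq_qpoch:
  assumes "cmod q < 1"
  shows "Bseq (qpoch q c)"
proof -
  have "convergent (\<lambda>k. qpoch q c (Suc k))"
    using convergent_prod_imp_convergent[OF convergent_prod_qpoch[OF assms]]
    by (simp add: qpoch_def lessThan_Suc_atMost)
  then show ?thesis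
    by (intro convergent_imp_Bseq) (simp add: convergent_Suc_iff)
qed

text \<open>A convergent infinite product without zero factors has a nonzero limit, so its partial
  products stay away from 0.\<close>

lemma Bseq_inverse_qpoch:
  assumes q: "cmod q < 1" and nz: "\<And>k. qpoch q c k \<noteq> 0"
  shows "Bseq (\<lambda>k. inverse (qpoch q c k))"
proof -
  have "(\<lambda>k. qpoch q c (Suc k)) \<longlonglongrightarrow> prodinf (\<lambda>i. 1 - c * q ^ i)"
    using convergent_prod_LIMSEQ[OF convergent_prod_qpoch[OF q]]
    by (simp add: qpoch_def lessThan_Suc_atMost)
  moreover have "1 - c * q ^ i \<noteq> 0" for i
    using nz[of "Suc i"] by (simp add: qpoch_Suc)
  then have "prodinf (\<lambda>i. 1 - c * q ^ i) \<noteq> 0"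
    by (intro prodinf_nonzero convergent_prod_qpoch q)
  ultimately have "(\<lambda>k. inverse (qpoch q c (Suc k))) \<longlonglongrightarrow> inverse (prodinf (\<lambda>i. 1 - c * q ^ i))"
    by (rule tendsto_inverse)
  from convergentI[OF this] show ?thesis
    by (intro convergent_imp_Bseq) (simp add: convergent_Suc_iff[of "\<lambda>k. inverse (qpoch q c k)"])
qed

lemma Bseq_qpoch_quotient:
  assumes "cmod q < 1" "\<And>k. qpoch q d k \<noteq> 0"
  shows "Bseq (\<lambda>k. qpoch q c k / qpoch q d k)"
  unfolding divide_inverse using assms by (intro Bseq_mult Bseq_qpoch Bseq_inverse_qpoch)

lemma one_minus_mult_power_nz:
  assumes "cmod q < 1" "cmod t < 1"
  shows "1 - t * q ^ i \<noteq> (0 :: complex)"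
proof -
  have "cmod (t * q ^ i) \<le> cmod t * 1"
    unfolding norm_mult norm_power using assms by (intro mult_left_mono power_le_one) auto
  with assms show ?thesis by auto
qed

lemma qpoch_nz:
  assumes "cmod q < 1" "cmod t < 1"
  shows "qpoch q t k \<noteq> 0"
  using one_minus_mult_power_nz[OF assms] by (simp add: qpoch_def)

section \<open>The Rogers-Fine identity\<close>

text \<open>Successive terms have ratio w q^(2m), which tends to 0 however large w is. This matters
  because b, and with it b t, is not bounded in size.\<close>

lemma square_power_tendsto_0:
  fixes q w :: complex
  assumes "cmod q < 1"
  shows "(\<lambda>m. w ^ m * q ^ (m * (m - 1))) \<longlonglongrightarrow> 0"
proof (rule summable_LIMSEQ_zero)
  have "(\<lambda>m. w * (q\<^sup>2) ^ m) \<longlonglongrightarrow> w * 0"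
    using assms by (intro tendsto_mult_left LIMSEQ_power_zero) (simp add: norm_power power_less_one_iff)
  then have "\<forall>\<^sub>F m in sequentially. cmod (w * (q\<^sup>2) ^ m) < 1 / 2"
    using order_tendstoD(2)[OF tendsto_norm, of _ "w * 0" sequentially "1/2"] by simp
  then obtain M where M: "\<And>m. m \<ge> M \<Longrightarrow> cmod (w * (q\<^sup>2) ^ m) < 1 / 2"
    by (auto simp: eventually_sequentially)
  show "summable (\<lambda>m. w ^ m * q ^ (m * (m - 1)))"
  proof (rule summable_ratio_test[of "1/2" M])
    fix m assume m: "m \<ge> M"
    have "Suc m * (Suc m - 1) = m * (m - 1) + 2 * m"
      by (cases m) auto
    then have "w ^ Suc m * q ^ (Suc m * (Suc m - 1)) = (w * (q\<^sup>2) ^ m) * (w ^ m * q ^ (m * (m - 1)))"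
      by (simp only: power_add power_mult[of q 2 m, symmetric] power_Suc mult_ac)
    then show "cmod (w ^ Suc m * q ^ (Suc m * (Suc m - 1))) \<le> 1 / 2 * cmod (w ^ m * q ^ (m * (m - 1)))"
      using M[OF m] by (simp only: norm_mult[of "w * (q\<^sup>2) ^ m"]) (intro mult_right_mono, auto)
  qed simp
qed

text \<open>The tails \<open>H m\<close>, with \<open>t * q ^ m\<close> in place of \<open>t\<close>, satisfy a first-order recurrence whose
  iteration produces the left-hand series term by term; the recurrence itself telescopes.\<close>

theorem rogers_fine:
  fixes q A b t :: complex
  assumes q: "cmod q < 1" and t: "cmod t < 1" and b: "b \<noteq> 0" and b_nz: "\<And>k. qpoch q b k \<noteq> 0"
  shows "(\<lambda>m. qpoch q A m * qpoch q (A * t * q / b) m * (b * t) ^ m * q ^ (m * (m - 1)) *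
      (1 - A * t * q ^ (2 * m)) / (qpoch q b m * qpoch q t (Suc m)))
    sums (\<Sum>k. qpoch q A k / qpoch q b k * t ^ k)"
proof -
  define p where "p k = qpoch q A k / qpoch q b k" for k
  define u where "u m k = p (k + m) * (t * q ^ m) ^ k" for m k
  define H where "H m = (\<Sum>k. u m k)" for m
  \<comment> \<open>The product of the first m multipliers obtained by solving \<open>H_rec\<close>
    for \<open>H m\<close>: \<open>e (Suc m) / e m\<close> is the coefficient of
    \<open>H (Suc m)\<close> divided by 1 - t q^m.\<close>
  define e where "e m = qpoch q (A * t * q / b) m * (b * t) ^ m * q ^ (m * (m - 1)) / qpoch q t m" for m
  obtain C where C: "C > 0" "\<And>k. cmod (p k) \<le> C"
    using Bseq_qpoch_quotient[OF q b_nz, of A] unfolding Bseq_def p_def by auto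
  have norm_tq: "cmod (t * q ^ m) \<le> cmod t" for m
    using q by (simp add: norm_mult norm_power mult_left_le power_le_one)
  have norm_u: "cmod (u m k) \<le> C * cmod t ^ k" for m k
    unfolding u_def norm_mult norm_power[of "t * q ^ m"]
    using C norm_tq[unfolded norm_mult] by (intro mult_mono power_mono) auto
  have geo: "summable (\<lambda>k. C * cmod t ^ k)"
    using t by (intro summable_mult summable_geometric) simp
  have u_summable: "summable (u m)" for m
    by (rule summable_comparison_test'[OF geo norm_u])
  have b_nz': "1 - b * q ^ i \<noteq> 0" for i
    using b_nz[of "Suc i"] by (simp add: qpoch_Suc)
  have p_Suc: "p (Suc i) = p i * ((1 - A * q ^ i) / (1 - b * q ^ i))" for i
    by (simp add: p_def qpoch_Suc)
  have H_rec: "(1 - t * q ^ m) * H m =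
      p m * (1 - A * t * q ^ (2 * m)) + (b - A * t * q * q ^ m) * t * q ^ (2 * m) * H (Suc m)" for m
  proof -
    \<comment> \<open>A creative-telescoping certificate: a multiple of the summand whose
      differences combine \<open>u m\<close> and \<open>u (Suc m)\<close> with coefficients free of
      k. Its value at k = 0 is the inhomogeneous term of the recurrence.\<close>
    define G where "G k = u m k * (1 - A * t * q ^ (2 * m) * q ^ k)" for k
    have "G \<longlonglongrightarrow> 0"
      unfolding G_def
    proof (rule tendsto_0_le[OF summable_LIMSEQ_zero[OF u_summable[of m]]])
      show "\<forall>\<^sub>F k in sequentially. cmod (u m k * (1 - A * t * q ^ (2 * m) * q ^ k)) \<le>
          cmod (u m k) * (1 + cmod (A * t))"
      proof (intro always_eventually allI)
        fix k
        have "cmod (A * t * q ^ (2 * m) * q ^ k) \<le> cmod (A * t)"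
          using q unfolding mult.assoc[of "A * t"] power_add[symmetric]
          by (simp add: norm_mult norm_power mult_left_le power_le_one)
        then have "cmod (1 - A * t * q ^ (2 * m) * q ^ k) \<le> 1 + cmod (A * t)"
          using norm_triangle_ineq4[of 1 "A * t * q ^ (2 * m) * q ^ k"] by simp
        then show "cmod (u m k * (1 - A * t * q ^ (2 * m) * q ^ k)) \<le> cmod (u m k) * (1 + cmod (A * t))"
          unfolding norm_mult[of "u m k"] by (intro mult_left_mono) auto
      qed
    qed
    from telescope_sums'[OF this]
    have "(\<lambda>k. G k - G (Suc k)) sums (p m * (1 - A * t * q ^ (2 * m)))"
      by (simp add: G_def u_def)
    moreover have "G k - G (Suc k) =
        (1 - t * q ^ m) * u m k - (b - A * t * q * q ^ m) * t * q ^ (2 * m) * u (Suc m) k" for k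
    proof -
      \<comment> \<open>With these quantities as atoms, the claim is a rational identity whose only
        denominator is 1 - b Q X.\<close>
      define Q X P where "Q = q ^ m" and "X = q ^ k" and "P = p (k + m) * (t * Q) ^ k"
      have nz: "1 - b * Q * X \<noteq> 0"
        using b_nz'[of "k + m"] by (simp add: Q_def X_def power_add mult_ac)
      have *: "u m k = P" "u m (Suc k) = P * ((1 - A * Q * X) / (1 - b * Q * X)) * (t * Q)"
        "u (Suc m) k = P * ((1 - A * Q * X) / (1 - b * Q * X)) * X"
        by (simp_all add: u_def P_def p_Suc Q_def X_def power_add power_mult_distrib
          power_mult[symmetric] mult_ac)
      have **: "q ^ (2 * m) = Q * Q" "q ^ Suc k = q * X"
        by (simp_all add: Q_def X_def mult_2 power_add)
      have "(1 - b * Q * X) * (G k - G (Suc k)) = (1 - b * Q * X) *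
          ((1 - t * q ^ m) * u m k - (b - A * t * q * q ^ m) * t * q ^ (2 * m) * u (Suc m) k)"
        unfolding G_def * ** Q_def[symmetric] X_def[symmetric] using nz
        by (simp add: divide_simps) (simp add: algebra_simps)
      with nz show ?thesis by simp
    qed
    moreover have "(\<lambda>k. (1 - t * q ^ m) * u m k - (b - A * t * q * q ^ m) * t * q ^ (2 * m) * u (Suc m) k)
        sums ((1 - t * q ^ m) * H m - (b - A * t * q * q ^ m) * t * q ^ (2 * m) * H (Suc m))"
      unfolding H_def by (intro sums_diff sums_mult summable_sums u_summable)
    ultimately have "p m * (1 - A * t * q ^ (2 * m)) =
        (1 - t * q ^ m) * H m - (b - A * t * q * q ^ m) * t * q ^ (2 * m) * H (Suc m)"
      by (simp add: sums_unique2)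
    then show ?thesis by simp
  qed
  \<comment> \<open>The remainder of the iteration. \<open>H\<close> is bounded uniformly in m since
    |t q^m| \<le> |t|, the quotient of q-factorials is bounded, and the quadratic power of q
    overcomes (b t)^m.\<close>
  have "(\<lambda>m. e m * H m) \<longlonglongrightarrow> 0"
  proof -
    have "cmod (H m) \<le> (\<Sum>k. C * cmod t ^ k)" for m
      unfolding H_def by (intro norm_suminf_le norm_u geo)
    then have "Bseq H" by (rule BseqI')
    moreover have "Bseq (\<lambda>m. qpoch q (A * t * q / b) m / qpoch q t m)"
      by (intro Bseq_qpoch_quotient q qpoch_nz t)
    ultimately have bseq: "Bseq (\<lambda>m. qpoch q (A * t * q / b) m / qpoch q t m * H m)"
      by (rule Bseq_mult[rotated])
    have "Zfun (\<lambda>m. (b * t) ^ m * q ^ (m * (m - 1))) sequentially"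
      using square_power_tendsto_0[OF q] by (simp only: tendsto_Zfun_iff diff_0_right)
    then have "Zfun (\<lambda>m. ((b * t) ^ m * q ^ (m * (m - 1))) * (qpoch q (A * t * q / b) m / qpoch q t m * H m)) sequentially"
      using bseq by (rule bounded_bilinear.Zfun_prod_Bfun[OF bounded_bilinear_mult])
    then show ?thesis
      by (simp add: e_def tendsto_Zfun_iff mult_ac)
  qed
  from telescope_sums'[OF this] have "(\<lambda>m. e m * H m - e (Suc m) * H (Suc m)) sums H 0"
    by (simp add: e_def)
  moreover have "e m * H m - e (Suc m) * H (Suc m) =
      qpoch q A m * qpoch q (A * t * q / b) m * (b * t) ^ m * q ^ (m * (m - 1)) *
      (1 - A * t * q ^ (2 * m)) / (qpoch q b m * qpoch q t (Suc m))" for m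
  proof -
    have nz: "1 - t * q ^ m \<noteq> 0"
      by (rule one_minus_mult_power_nz[OF q t])
    have "Suc m * (Suc m - 1) = m * (m - 1) + 2 * m"
      by (cases m) auto
    then have "e (Suc m) = e m / (1 - t * q ^ m) * ((1 - A * t * q / b * q ^ m) * (b * t) * q ^ (2 * m))"
      by (simp only: e_def qpoch_Suc power_add power_Suc) simp
    also have "(1 - A * t * q / b * q ^ m) * (b * t) * q ^ (2 * m) = (b - A * t * q * q ^ m) * t * q ^ (2 * m)"
      using b by (simp add: field_simps)
    finally have "e m * H m - e (Suc m) * H (Suc m) =
        e m / (1 - t * q ^ m) * ((1 - t * q ^ m) * H m - (b - A * t * q * q ^ m) * t * q ^ (2 * m) * H (Suc m))"
      using nz by (simp add: right_diff_distrib mult.assoc)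
    also have "\<dots> = e m / (1 - t * q ^ m) * (p m * (1 - A * t * q ^ (2 * m)))"
      unfolding H_rec by simp
    finally show ?thesis
      by (simp add: e_def p_def qpoch_Suc mult_ac)
  qed
  ultimately show ?thesis
    by (simp add: H_def u_def p_def)
qed

section \<open>Partial fractions by Lagrange interpolation\<close>

lemma degree_prod_linear_le:
  fixes u v :: "'b \<Rightarrow> complex"
  assumes "finite S"
  shows "degree (\<Prod>s\<in>S. [:u s, v s:]) \<le> card S"
proof -
  have "degree (\<Prod>s\<in>S. [:u s, v s:]) \<le> (\<Sum>s\<in>S. degree [:u s, v s:])"
    by (rule degree_prod_sum_le[OF assms, unfolded comp_def])
  also have "\<dots> \<le> (\<Sum>s\<in>S. 1)"
    by (intro sum_mono) simp
  finally show ?thesis by simp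
qed

lemma coeff_card_prod_linear:
  fixes u v :: "'b \<Rightarrow> complex"
  assumes "finite S"
  shows "coeff (\<Prod>s\<in>S. [:u s, v s:]) (card S) = (\<Prod>s\<in>S. v s)"
  using assms
proof (induction S rule: finite_induct)
  case (insert t S)
  have "coeff (\<Prod>s\<in>S. [:u s, v s:]) (Suc (card S)) = 0"
    using degree_prod_linear_le[OF insert(1), of u v] by (intro coeff_eq_0) simp
  with insert show ?case by (simp add: coeff_pCons)
qed simp

text \<open>Evaluation at \<open>0\<close> of the Lagrange interpolation, at the nodes \<open>y r\<close>, of the polynomial
  \<open>(\<Prod>s\<in>S. 1 - b s * t / y s) - (\<Prod>s\<in>S. b s) * (\<Prod>s\<in>S. 1 - t / y s)\<close> in \<open>t\<close>, whose degree is
  less than the number of nodes.\<close>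

lemma sum_prod_partial_fraction:
  fixes b y :: "'b \<Rightarrow> complex"
  assumes fin: "finite S" and inj: "inj_on y S" and y_nz: "\<And>s. s \<in> S \<Longrightarrow> y s \<noteq> 0"
  shows "(\<Sum>r\<in>S. (\<Prod>s\<in>S. 1 - b s * y r / y s) / (\<Prod>s\<in>S - {r}. 1 - y r / y s)) = 1 - (\<Prod>s\<in>S. b s)"
proof (cases "S = {}")
  case False
  define p where "p = (\<Prod>s\<in>S. [:1, - b s / y s:])"
  define w where "w = (\<Prod>s\<in>S. [:1, - 1 / y s:])"
  define l where "l r = (\<Prod>s\<in>S - {r}. [:1, - 1 / y s:])" for r
  define d where "d r = (\<Prod>s\<in>S - {r}. 1 - y r / y s)" for r
  define B where "B = (\<Prod>s\<in>S. b s)"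
  define R where "R = p - smult B w"
  define L where "L = (\<Sum>r\<in>S. smult (poly p (y r) / d r) (l r))"
  have card: "card S > 0"
    using False fin by (simp add: card_gt_0_iff)
  have d_nz: "d r \<noteq> 0" if "r \<in> S" for r
    unfolding d_def using fin inj y_nz that by (auto simp: inj_on_def)
  have "degree R \<le> card S"
    unfolding R_def p_def w_def
    by (intro degree_diff_le order.trans[OF degree_smult_le] degree_prod_linear_le fin)
  moreover have "coeff R (card S) = 0"
    unfolding R_def p_def w_def B_def
    by (simp add: coeff_card_prod_linear[OF fin] flip: prod.distrib)
  \<comment> \<open>If the degree were \<open>card S\<close>, the leading coefficient would be 0, so
    \<open>R\<close> would be 0 and have degree 0, against \<open>card S > 0\<close>.\<close>
  ultimately have "degree R < card S"
    using card by (metis degree_0 leading_coeff_0_iff order.not_eq_order_implies_strict)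
  moreover have "degree L < card S"
  proof -
    have "degree (l r) \<le> card S - 1" if "r \<in> S" for r
      using degree_prod_linear_le[of "S - {r}"] fin that unfolding l_def by simp
    then have "degree L \<le> card S - 1"
      unfolding L_def by (intro degree_sum_le fin order.trans[OF degree_smult_le])
    then show ?thesis using card by linarith
  qed
  moreover have "poly R (y t) = poly L (y t)" if t: "t \<in> S" for t
  proof -
    have "poly w (y t) = 0"
      unfolding w_def poly_prod using fin t y_nz by (intro prod_zero bexI[of _ t]) auto
    moreover have "poly L (y t) = (\<Sum>r\<in>S. if r = t then poly p (y t) else 0)"
      unfolding L_def poly_sum
    proof (intro sum.cong refl)
      fix r assume r: "r \<in> S"
      show "poly (smult (poly p (y r) / d r) (l r)) (y t) = (if r = t then poly p (y t) else 0)"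
      proof (cases "r = t")
        case True
        have "poly (l t) (y t) = d t"
          unfolding l_def d_def poly_prod by simp
        with True d_nz[OF t] show ?thesis by simp
      next
        case False
        have "poly (l r) (y t) = 0"
          unfolding l_def poly_prod using fin t y_nz False by (intro prod_zero bexI[of _ t]) auto
        with False show ?thesis by simp
      qed
    qed
    ultimately show ?thesis
      using fin t by (simp add: R_def)
  qed
  ultimately have "R = L"
    using card_image[OF inj] by (intro poly_eqI_degree[of "y ` S"]) auto
  \<comment> \<open>Every linear factor is 1 at 0, so \<open>R\<close> gives 1 - B there and
    \<open>L\<close> gives the bare sum of its coefficients.\<close>
  then have "poly L 0 = poly R 0" by simp
  then show ?thesis
    by (simp add: L_def R_def B_def l_def p_def w_def d_def poly_sum poly_prod mult.commute)
qed simp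

section \<open>Vandermonde products\<close>

definition vandermonde :: "nat \<Rightarrow> (nat \<Rightarrow> complex) \<Rightarrow> complex" where
  "vandermonde n y = (\<Prod>s=1..n. \<Prod>r\<in>{1..<s}. y s - y r)"

text \<open>K collects the factors that avoid index r, together with the sign from the pairs in
  which r is the larger index. Leaving it existential spares computing it, since only ratios for two
  values of t matter.\<close>

lemma vandermonde_fun_upd:
  assumes "r \<in> {1..n}"
  shows "\<exists>K. \<forall>t. vandermonde n (y(r := t)) = K * (\<Prod>s\<in>{1..n} - {r}. y s - t)"
  using assms
proof (induction n)
  case (Suc n)
  have Suc_eq: "vandermonde (Suc n) u = vandermonde n u * (\<Prod>i\<in>{1..n}. u (Suc n) - u i)" for u
    by (simp add: vandermonde_def atLeastLessThanSuc_atLeastAtMost)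
  show ?case
  proof (cases "r = Suc n")
    case True
    have V: "vandermonde n (y(r := t)) = vandermonde n y" for t
      unfolding vandermonde_def True by (intro prod.cong refl) auto
    have "(\<Prod>i\<in>{1..n}. t - (y(r := t)) i) = (-1) ^ n * (\<Prod>i\<in>{1..n}. y i - t)" for t
    proof -
      have "(\<Prod>i\<in>{1..n}. t - (y(r := t)) i) = (\<Prod>i\<in>{1..n}. (-1) * (y i - t))"
        using True by (intro prod.cong) auto
      then show ?thesis by (subst (asm) prod.distrib) simp
    qed
    moreover have "{1..Suc n} - {r} = {1..n}"
      using True by auto
    ultimately have "\<forall>t. vandermonde (Suc n) (y(r := t)) =
        (vandermonde n y * (-1) ^ n) * (\<Prod>s\<in>{1..Suc n} - {r}. y s - t)"
      unfolding Suc_eq V using True by simp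
    then show ?thesis ..
  next
    case False
    with Suc.prems have r: "r \<in> {1..n}" by simp
    from Suc.IH[OF this] obtain K where
      K: "\<And>t. vandermonde n (y(r := t)) = K * (\<Prod>s\<in>{1..n} - {r}. y s - t)" by blast
    have last: "(\<Prod>i\<in>{1..n}. (y(r := t)) (Suc n) - (y(r := t)) i) =
        (y (Suc n) - t) * (\<Prod>i\<in>{1..n} - {r}. y (Suc n) - y i)" for t
      using False r by (subst prod.remove[of _ r]) (auto intro!: prod.cong)
    have ins: "{1..Suc n} - {r} = insert (Suc n) ({1..n} - {r})"
      using False by auto
    have "\<forall>t. vandermonde (Suc n) (y(r := t)) =
        (K * (\<Prod>i\<in>{1..n} - {r}. y (Suc n) - y i)) * (\<Prod>s\<in>{1..Suc n} - {r}. y s - t)"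
      unfolding Suc_eq K last ins by simp
    then show ?thesis ..
  qed
qed simp

lemma vandermonde_fun_upd_cross:
  assumes "r \<in> {1..n}"
  shows "vandermonde n (y(r := t)) * (\<Prod>s\<in>{1..n} - {r}. y s - y r) =
    vandermonde n y * (\<Prod>s\<in>{1..n} - {r}. y s - t)"
proof -
  from vandermonde_fun_upd[OF assms] obtain K where
    K: "\<And>t. vandermonde n (y(r := t)) = K * (\<Prod>s\<in>{1..n} - {r}. y s - t)" by metis
  from K[of "y r"] show ?thesis by (simp add: K)
qed

section \<open>Multi-indices of given weight\<close>

lemma multi_indices_iff: "k \<in> multi_indices n \<longleftrightarrow> (\<forall>i. i \<notin> {1..n} \<longrightarrow> k i = undefined)"
  by (auto simp: multi_indices_def PiE_iff extensional_def)

lemma finite_weight_eq: "finite {k \<in> multi_indices n. weight n k = N}"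
proof (rule finite_subset)
  show "{k \<in> multi_indices n. weight n k = N} \<subseteq> {1..n} \<rightarrow>\<^sub>E {..N}"
  proof
    fix k assume "k \<in> {k \<in> multi_indices n. weight n k = N}"
    then have k: "k \<in> multi_indices n" "weight n k = N" by auto
    have "k i \<le> weight n k" if "i \<in> {1..n}" for i
      unfolding weight_def using that by (intro member_le_sum) auto
    with k show "k \<in> {1..n} \<rightarrow>\<^sub>E {..N}"
      by (auto simp: multi_indices_def)
  qed
qed (intro finite_PiE, auto)

lemma weight_fun_upd_Suc:
  assumes "r \<in> {1..n}"
  shows "weight n (k(r := Suc (k r))) = Suc (weight n k)"
  using assms unfolding weight_def by (simp add: sum.remove[of _ r])

lemma bij_betw_multi_indices_Suc:
  assumes "r \<in> {1..n}"
  shows "bij_betw (\<lambda>k. k(r := Suc (k r))) {k \<in> multi_indices n. weight n k = N}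
    {k \<in> multi_indices n. weight n k = Suc N \<and> k r \<noteq> 0}"
proof (rule bij_betw_byWitness[where f' = "\<lambda>k. k(r := k r - 1)"])
  show "(\<lambda>k. k(r := k r - 1)) ` {k \<in> multi_indices n. weight n k = Suc N \<and> k r \<noteq> 0} \<subseteq>
      {k \<in> multi_indices n. weight n k = N}"
  proof (rule image_subsetI)
    fix k assume k: "k \<in> {k \<in> multi_indices n. weight n k = Suc N \<and> k r \<noteq> 0}"
    then have "k(r := k r - 1) \<in> multi_indices n"
      using assms by (auto simp: multi_indices_iff)
    moreover have "weight n (k(r := k r - 1)) = N"
      using weight_fun_upd_Suc[OF assms, of "k(r := k r - 1)"] k by simp
    ultimately show "k(r := k r - 1) \<in> {k \<in> multi_indices n. weight n k = N}" by simp
  qed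
qed (use assms in \<open>auto simp: multi_indices_iff weight_fun_upd_Suc fun_eq_iff\<close>)

section \<open>Milne's A_n q-binomial theorem\<close>

text \<open>\<open>generic\<close> keeps the nodes distinct for every multi-index, as interpolation
  requires, and \<open>q_power\<close> excludes roots of unity, which would annihilate the diagonal
  denominators.\<close>

locale generic_nodes =
  fixes q :: complex and x :: "nat \<Rightarrow> complex" and n :: nat
  assumes q_nz: "q \<noteq> 0"
    and q_power: "q ^ Suc i \<noteq> 1"
    and x_nz: "r \<in> {1..n} \<Longrightarrow> x r \<noteq> 0"
    and generic: "r \<in> {1..n} \<Longrightarrow> s \<in> {1..n} \<Longrightarrow> r \<noteq> s \<Longrightarrow> x r * q ^ i \<noteq> x s * q ^ j"
begin

definition node :: "(nat \<Rightarrow> nat) \<Rightarrow> nat \<Rightarrow> complex" where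
  "node k r = x r * q ^ k r"

text \<open>The weight common to both series, with q^(sum (r-1) k_r) already absorbed into the
  Vandermonde quotient; see \<open>vandermonde_node\<close>.\<close>

definition coef :: "(nat \<Rightarrow> complex) \<Rightarrow> (nat \<Rightarrow> nat) \<Rightarrow> complex" where
  "coef a k = vandermonde n (node k) / vandermonde n x *
    (\<Prod>r=1..n. \<Prod>s=1..n. qpoch q (a s * x r / x s) (k r) / qpoch q (q * x r / x s) (k r))"

lemma node_nz: "r \<in> {1..n} \<Longrightarrow> node k r \<noteq> 0"
  using x_nz q_nz by (simp add: node_def)

lemma inj_node: "inj_on (node k) {1..n}"
  unfolding inj_on_def node_def using generic by blast

lemma denom_nz:
  assumes "r \<in> {1..n}" "s \<in> {1..n}"
  shows "1 - q * x r / x s * q ^ i \<noteq> 0"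
proof (cases "r = s")
  case True
  with assms x_nz q_power show ?thesis by simp
next
  case False
  with generic[of r s "Suc i" 0] assms x_nz show ?thesis by (auto simp: field_simps)
qed

text \<open>Raising index r multiplies the q-factorial quotients by prod_s (1 - a_s x_r q^(m_r) /
  x_s) / (1 - q x_r q^(m_r) / x_s). The denominator is the interpolation numerator at
  \<open>m'\<close> with parameters 1, the numerator the one at \<open>m\<close> with parameters
  a_s. The change of the Vandermonde product cancels against the products over s \<noteq> r.\<close>

lemma coef_Suc:
  fixes m :: "nat \<Rightarrow> nat"
  assumes r: "r \<in> {1..n}"
  defines "m' \<equiv> m(r := Suc (m r))"
  shows "coef a m' * ((\<Prod>s=1..n. 1 - q ^ m' s * node m' r / node m' s) /
        (\<Prod>s\<in>{1..n} - {r}. 1 - node m' r / node m' s)) =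
    coef a m * ((\<Prod>s=1..n. 1 - a s * q ^ m s * node m r / node m s) /
        (\<Prod>s\<in>{1..n} - {r}. 1 - node m r / node m s))"
proof -
  have node': "node m' = (node m)(r := q * node m r)"
    by (auto simp: node_def m'_def)
  define E where "E k = (\<Prod>s\<in>{1..n} - {r}. node m s - node k r)" for k
  define P where "P = (\<Prod>s\<in>{1..n} - {r}. node m s)"
  define g where "g i k = (\<Prod>s=1..n. qpoch q (a s * x i / x s) k / qpoch q (q * x i / x s) k)" for i k
  have P_nz: "P \<noteq> 0"
    unfolding P_def using node_nz by auto
  have E_nz: "E k \<noteq> 0" if k: "\<And>s. s \<noteq> r \<Longrightarrow> k s = m s" for k
  proof -
    have "node m s - node k r \<noteq> 0" if s: "s \<in> {1..n} - {r}" for s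
      using generic[of s r "m s" "k r"] r s unfolding node_def by simp
    then show ?thesis unfolding E_def by simp
  qed
  have E_nz0: "E m \<noteq> 0" "E m' \<noteq> 0"
    by (rule E_nz, simp add: m'_def)+
  have quot: "(\<Prod>s\<in>{1..n} - {r}. 1 - node k r / node k s) = E k / P"
    if "\<And>s. s \<noteq> r \<Longrightarrow> node k s = node m s" for k
    unfolding E_def P_def prod_dividef[symmetric]
    using node_nz that by (intro prod.cong refl) (simp add: diff_divide_distrib)
  have V: "vandermonde n (node m') * E m = vandermonde n (node m) * E m'"
    using vandermonde_fun_upd_cross[OF r, of "node m" "node m' r"] by (simp add: E_def node')
  have num': "(\<Prod>s=1..n. 1 - q ^ m' s * node m' r / node m' s) = (\<Prod>s=1..n. 1 - q * x r / x s * q ^ m r)"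
    using x_nz q_nz by (intro prod.cong refl) (auto simp: node_def m'_def)
  have num: "(\<Prod>s=1..n. 1 - a s * q ^ m s * node m r / node m s) = (\<Prod>s=1..n. 1 - a s * x r / x s * q ^ m r)"
    using x_nz q_nz by (intro prod.cong refl) (auto simp: node_def)
  have den_nz: "(\<Prod>s=1..n. 1 - q * x r / x s * q ^ m r) \<noteq> 0"
    using denom_nz r by auto
  have g_Suc: "g r (Suc (m r)) * (\<Prod>s=1..n. 1 - q * x r / x s * q ^ m r) =
      g r (m r) * (\<Prod>s=1..n. 1 - a s * x r / x s * q ^ m r)"
    unfolding g_def qpoch_Suc times_divide_times_eq[symmetric] prod.distrib
    using den_nz by (simp add: prod_dividef)
  have g_prod: "(\<Prod>i=1..n. g i (m' i)) = g r (Suc (m r)) * (\<Prod>i\<in>{1..n} - {r}. g i (m i))"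
    using r by (subst prod.remove[of _ r]) (auto simp: m'_def intro!: prod.cong)
  have g_prod0: "(\<Prod>i=1..n. g i (m i)) = g r (m r) * (\<Prod>i\<in>{1..n} - {r}. g i (m i))"
    using r by (subst prod.remove[of _ r]) auto
  define u where "u = (\<Prod>i\<in>{1..n} - {r}. g i (m i))"
  define d where "d = (\<Prod>s=1..n. 1 - q * x r / x s * q ^ m r)"
  define d' where "d' = (\<Prod>s=1..n. 1 - a s * x r / x s * q ^ m r)"
  have quot1: "(\<Prod>s\<in>{1..n} - {r}. 1 - node m r / node m s) = E m / P"
    by (rule quot) simp
  have quot2: "(\<Prod>s\<in>{1..n} - {r}. 1 - node m' r / node m' s) = E m' / P"
    by (rule quot) (simp add: node')
  have "vandermonde n (node m') / E m' = vandermonde n (node m) / E m"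
    using V E_nz0 by (simp add: frac_eq_eq)
  then have "vandermonde n (node m') / E m' * (g r (Suc (m r)) * d) * (u * P / vandermonde n x) =
      vandermonde n (node m) / E m * (g r (m r) * d') * (u * P / vandermonde n x)"
    using g_Suc by (simp add: d_def d'_def)
  then show ?thesis
    unfolding coef_def g_def[symmetric] g_prod g_prod0 num num' quot1 quot2
      d_def[symmetric] d'_def[symmetric] u_def[symmetric] by (simp add: mult_ac)
qed

theorem milne_q_binomial:
  "(\<Sum>k | k \<in> multi_indices n \<and> weight n k = N. coef a k) = qpoch q (\<Prod>s=1..n. a s) N / qpoch q q N"
proof (induction N)
  case 0
  have "{k \<in> multi_indices n. weight n k = 0} = {\<lambda>i. if i \<in> {1..n} then 0 else undefined}"
    by (auto simp: multi_indices_iff weight_def fun_eq_iff)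
  moreover have "vandermonde n (node (\<lambda>i. if i \<in> {1..n} then 0 else undefined)) = vandermonde n x"
    unfolding vandermonde_def node_def by (intro prod.cong refl) auto
  moreover have "vandermonde n x \<noteq> 0"
    unfolding vandermonde_def using generic[of _ _ 0 0] by auto
  ultimately show ?case by (simp add: coef_def)
next
  case (Suc N)
  let ?I = "\<lambda>N. {k \<in> multi_indices n. weight n k = N}"
  let ?A = "\<Prod>s=1..n. a s"
  \<comment> \<open>The summands of \<open>sum_prod_partial_fraction\<close> for the parameters c_s
    q^(k_s). The powers of q multiply to q^|k|, so the total depends on k only through its
    weight.\<close>
  define D where "D c k r = (\<Prod>s=1..n. 1 - c s * q ^ k s * node k r / node k s) /
        (\<Prod>s\<in>{1..n} - {r}. 1 - node k r / node k s)" for c k r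
  have D_sum: "(\<Sum>r=1..n. D c k r) = 1 - (\<Prod>s=1..n. c s) * q ^ weight n k" for c k
    unfolding D_def weight_def
    using sum_prod_partial_fraction[of "{1..n}" "node k" "\<lambda>s. c s * q ^ k s"] inj_node node_nz
    by (simp add: prod.distrib power_sum)
  then have coef_D_sum: "(\<Sum>r=1..n. coef a k * D c k r) = (1 - (\<Prod>s=1..n. c s) * q ^ weight n k) * coef a k" for c k
    by (metis mult.commute sum_distrib_left)
  \<comment> \<open>The factor s = r of the numerator is 1 - q^0 = 0. This discards precisely the
    multi-indices that are not of the form k + e_r.\<close>
  have D_0: "D (\<lambda>_. 1) k r = 0" if "r \<in> {1..n}" "k r = 0" for k r
  proof -
    have "(\<Prod>s=1..n. 1 - 1 * q ^ k s * node k r / node k s) = 0"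
      using that node_nz by (intro prod_zero bexI[of _ r]) auto
    then show ?thesis by (simp add: D_def)
  qed
  have "(1 - q ^ Suc N) * (\<Sum>k\<in>?I (Suc N). coef a k) = (\<Sum>k\<in>?I (Suc N). \<Sum>r=1..n. coef a k * D (\<lambda>_. 1) k r)"
    unfolding sum_distrib_left coef_D_sum by (intro sum.cong refl) simp
  also have "\<dots> = (\<Sum>r=1..n. \<Sum>k\<in>?I (Suc N). coef a k * D (\<lambda>_. 1) k r)"
    by (rule sum.swap)
  also have "\<dots> = (\<Sum>r=1..n. \<Sum>k\<in>?I N. coef a k * D a k r)"
  proof (rule sum.cong[OF refl])
    fix r assume r: "r \<in> {1..n}"
    have "(\<Sum>k\<in>?I (Suc N). coef a k * D (\<lambda>_. 1) k r) =
        (\<Sum>k | k \<in> multi_indices n \<and> weight n k = Suc N \<and> k r \<noteq> 0. coef a k * D (\<lambda>_. 1) k r)"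
      by (rule sum.mono_neutral_right[OF finite_weight_eq]) (use D_0[OF r] in auto)
    also have "\<dots> = (\<Sum>k\<in>?I N. coef a (k(r := Suc (k r))) * D (\<lambda>_. 1) (k(r := Suc (k r))) r)"
      by (rule sum.reindex_bij_betw[OF bij_betw_multi_indices_Suc[OF r], symmetric])
    also have "\<dots> = (\<Sum>k\<in>?I N. coef a k * D a k r)"
      using coef_Suc[OF r] unfolding D_def by (intro sum.cong refl) simp
    finally show "(\<Sum>k\<in>?I (Suc N). coef a k * D (\<lambda>_. 1) k r) = (\<Sum>k\<in>?I N. coef a k * D a k r)" .
  qed
  also have "\<dots> = (\<Sum>k\<in>?I N. \<Sum>r=1..n. coef a k * D a k r)"
    by (rule sum.swap)
  also have "\<dots> = (1 - ?A * q ^ N) * (\<Sum>k\<in>?I N. coef a k)"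
    unfolding sum_distrib_left coef_D_sum by (intro sum.cong refl) simp
  also have "\<dots> = (1 - ?A * q ^ N) * (qpoch q ?A N / qpoch q q N)"
    using Suc.IH by simp
  finally have "(1 - q ^ Suc N) * (\<Sum>k\<in>?I (Suc N). coef a k) = (1 - ?A * q ^ N) * (qpoch q ?A N / qpoch q q N)" .
  moreover have "1 - q ^ Suc N \<noteq> 0"
    using q_power[of N] by simp
  ultimately have "(\<Sum>k\<in>?I (Suc N). coef a k) =
      (1 - ?A * q ^ N) * (qpoch q ?A N / qpoch q q N) / (1 - q ^ Suc N)"
    by (subst nonzero_eq_divide_eq) (simp_all only: mult.commute not_False_eq_True)
  then show ?case
    by (simp add: qpoch_Suc mult.commute)
qed

end

section \<open>Absolute convergence and summation by weight\<close>

lemma double_choose_two: "2 * (N choose 2) = N * (N - 1)"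
proof -
  have "even (N * (N - 1))"
    by (cases N) auto
  then show ?thesis
    by (simp only: choose_two dvd_mult_div_cancel)
qed

text \<open>A finite set of multi-indices lies in a box, and over a box the sum factors into n
  truncated geometric series.\<close>

lemma summable_on_power_weight:
  fixes r :: real
  assumes r: "0 \<le> r" "r < 1"
  shows "(\<lambda>k. r ^ weight n k) summable_on multi_indices n"
proof (rule nonneg_bounded_partial_sums_imp_summable_on)
  show "\<forall>\<^sub>F X in finite_subsets_at_top (multi_indices n). (\<Sum>k\<in>X. r ^ weight n k) \<le> (1 / (1 - r)) ^ n"
  proof (rule eventually_finite_subsets_at_top_weakI)
    fix X assume X: "finite X" "X \<subseteq> multi_indices n"
    \<comment> \<open>Any common bound for the entries of members of \<open>X\<close> would serve as
      the side of the box.\<close>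
    define m where "m = (\<Sum>k\<in>X. weight n k)"
    have "k i \<le> m" if k: "k \<in> X" and i: "i \<in> {1..n}" for k i
    proof -
      have "k i \<le> weight n k"
        unfolding weight_def using i by (intro member_le_sum) auto
      also have "\<dots> \<le> m"
        unfolding m_def using X k by (intro member_le_sum) auto
      finally show ?thesis .
    qed
    then have "X \<subseteq> {1..n} \<rightarrow>\<^sub>E {..m}"
      using X(2) unfolding multi_indices_def PiE_iff by fast
    then have "(\<Sum>k\<in>X. r ^ weight n k) \<le> (\<Sum>k\<in>{1..n} \<rightarrow>\<^sub>E {..m}. \<Prod>i=1..n. r ^ k i)"
      unfolding weight_def power_sum using r by (intro sum_mono2 finite_PiE prod_nonneg) auto
    also have "\<dots> = (\<Prod>i\<in>{1..n}. \<Sum>j\<le>m. r ^ j)"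
      by (subst prod_sum_PiE) auto
    also have "\<dots> \<le> (\<Prod>i\<in>{1..n}. 1 / (1 - r))"
    proof (intro prod_mono conjI)
      have "(\<Sum>j\<le>m. r ^ j) \<le> (\<Sum>j. r ^ j)"
        using r by (intro sum_le_suminf summable_geometric) auto
      then show "(\<Sum>j\<le>m. r ^ j) \<le> 1 / (1 - r)"
        using r by (simp add: suminf_geometric)
    qed (use r in \<open>simp add: sum_nonneg\<close>)
    finally show "(\<Sum>k\<in>X. r ^ weight n k) \<le> (1 / (1 - r)) ^ n" by simp
  qed
qed (use r in simp)

text \<open>Reduces the n-fold series to an ordinary one: a bounded weight times a geometrically
  small factor is absolutely summable, so it may be regrouped into the finite fibres of
  \<open>weight n\<close>.\<close>

lemma has_sum_multi_indices_by_weight: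
  fixes w :: "(nat \<Rightarrow> nat) \<Rightarrow> complex" and c :: "nat \<Rightarrow> complex"
  assumes r: "0 \<le> r" "r < 1"
    and c: "\<And>N. cmod (c N) \<le> C * r ^ N"
    and w: "\<And>k. k \<in> multi_indices n \<Longrightarrow> cmod (w k) \<le> D"
  defines "f \<equiv> \<lambda>k. w k * c (weight n k)"
  shows "f summable_on multi_indices n"
    and "(\<lambda>N. (\<Sum>k | k \<in> multi_indices n \<and> weight n k = N. w k) * c N) sums infsum f (multi_indices n)"
proof -
  let ?I = "\<lambda>N. {k \<in> multi_indices n. weight n k = N}"
  have "(\<lambda>k. norm (f k)) summable_on multi_indices n"
  proof (rule summable_on_comparison_test)
    show "(\<lambda>k. D * (C * r ^ weight n k)) summable_on multi_indices n"
      by (intro summable_on_cmult_right summable_on_power_weight r)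
    fix k assume k: "k \<in> multi_indices n"
    have "0 \<le> D"
      using norm_ge_zero w[OF k] by (rule order.trans)
    with w[OF k] c show "norm (f k) \<le> D * (C * r ^ weight n k)"
      unfolding f_def norm_mult by (intro mult_mono) auto
  qed simp
  then show summable: "f summable_on multi_indices n"
    by (rule abs_summable_summable)
  have bij: "bij_betw snd (SIGMA N:UNIV. ?I N) (multi_indices n)"
    by (rule bij_betw_byWitness[where f' = "\<lambda>k. (weight n k, k)"]) auto
  have "((\<lambda>p. f (snd p)) has_sum infsum f (multi_indices n)) (SIGMA N:UNIV. ?I N)"
    using has_sum_infsum[OF summable] by (simp add: has_sum_reindex_bij_betw[OF bij])
  then have "((\<lambda>N. \<Sum>k\<in>?I N. f k) has_sum infsum f (multi_indices n)) UNIV"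
    by (rule has_sum_SigmaD) (simp add: has_sum_finite finite_weight_eq)
  moreover have "(\<Sum>k\<in>?I N. f k) = (\<Sum>k\<in>?I N. w k) * c N" for N
    unfolding f_def sum_distrib_right by (intro sum.cong refl) simp
  ultimately show "(\<lambda>N. (\<Sum>k\<in>?I N. w k) * c N) sums infsum f (multi_indices n)"
    by (simp add: has_sum_imp_sums)
qed

section \<open>Bounds for the weights\<close>

context generic_nodes
begin

lemma qpoch_denom_nz:
  assumes "r \<in> {1..n}" "s \<in> {1..n}"
  shows "qpoch q (q * x r / x s) k \<noteq> 0"
  unfolding qpoch_def prod_zero_iff[OF finite_lessThan] using denom_nz[OF assms] by blast

lemma coef_bounded:
  assumes q: "cmod q < 1"
  shows "\<exists>D. \<forall>k. cmod (coef a k) \<le> D"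
proof -
  have "\<exists>K. \<forall>k. cmod (qpoch q (a s * x r / x s) k / qpoch q (q * x r / x s) k) \<le> K"
    if "r \<in> {1..n}" "s \<in> {1..n}" for r s
    using Bseq_qpoch_quotient[OF q qpoch_denom_nz[OF that]] unfolding Bseq_def by blast
  then obtain K where K: "\<And>r s k. r \<in> {1..n} \<Longrightarrow> s \<in> {1..n} \<Longrightarrow>
      cmod (qpoch q (a s * x r / x s) k / qpoch q (q * x r / x s) k) \<le> K r s"
    by metis
  have node: "cmod (node k r) \<le> cmod (x r)" for k r
    using q by (simp add: node_def norm_mult norm_power mult_left_le power_le_one)
  have "cmod (vandermonde n (node k)) \<le> (\<Prod>s=1..n. \<Prod>r\<in>{1..<s}. cmod (x s) + cmod (x r))" for k
    unfolding vandermonde_def prod_norm[symmetric]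
    by (intro prod_mono conjI prod_nonneg ballI norm_ge_zero
      order.trans[OF norm_triangle_ineq4] add_mono node)
  moreover have "cmod (\<Prod>r=1..n. \<Prod>s=1..n. qpoch q (a s * x r / x s) (k r) / qpoch q (q * x r / x s) (k r)) \<le>
      (\<Prod>r=1..n. \<Prod>s=1..n. K r s)" for k
    unfolding prod_norm[symmetric]
    by (intro prod_mono conjI prod_nonneg ballI norm_ge_zero K)
  ultimately have "cmod (coef a k) \<le> (\<Prod>s=1..n. \<Prod>r\<in>{1..<s}. cmod (x s) + cmod (x r)) / cmod (vandermonde n x) *
      (\<Prod>r=1..n. \<Prod>s=1..n. K r s)" for k
    unfolding coef_def norm_mult norm_divide[of "vandermonde n (node k)"]
    by (intro mult_mono divide_right_mono divide_nonneg_nonneg prod_nonneg ballI) auto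
  then show ?thesis by blast
qed

text \<open>Multiplying the factor of a pair r < s by q^(k_s) makes it a quotient of node
  differences. Each s is the larger index of s - 1 pairs, whence the exponent (s-1) k_s.\<close>

lemma vandermonde_node:
  "(\<Prod>s=1..n. \<Prod>r\<in>{1..<s}. (1 - q powi (int (k r) - int (k s)) * x r / x s) / (1 - x r / x s)) *
    q ^ (\<Sum>r=1..n. (r - 1) * k r) = vandermonde n (node k) / vandermonde n x"
proof -
  have "(1 - q powi (int (k r) - int (k s)) * x r / x s) / (1 - x r / x s) * q ^ k s =
      (node k s - node k r) / (x s - x r)" if "s \<in> {1..n}" "r \<in> {1..<s}" for r s
  proof -
    have nz: "x s \<noteq> 0" "x s - x r \<noteq> 0"
      using that x_nz[of s] generic[of s r 0 0] by auto
    have "q powi (int (k r) - int (k s)) = q ^ k r / q ^ k s"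
      using q_nz by (simp add: power_int_diff)
    then show ?thesis
      using nz q_nz by (simp add: node_def field_simps)
  qed
  then have "(\<Prod>s=1..n. \<Prod>r\<in>{1..<s}. (1 - q powi (int (k r) - int (k s)) * x r / x s) / (1 - x r / x s) * q ^ k s) =
      (\<Prod>s=1..n. \<Prod>r\<in>{1..<s}. (node k s - node k r) / (x s - x r))"
    by (intro prod.cong refl) blast
  then show ?thesis
    by (simp add: vandermonde_def prod.distrib prod_dividef power_sum power_mult[symmetric] mult.commute)
qed

end

section \<open>The transformation of multiple series\<close>

text \<open>Summability belongs to the conclusion because \<open>infsum\<close> is 0 by convention
  on non-summable families. Requiring \<open>a ^ (n - 1) \<noteq> 0\<close> instead of a \<noteq> 0
  admits a = 0 when n = 1.\<close>

theorem theorem6p1: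
  fixes q a b z :: complex and x :: "nat \<Rightarrow> complex" and n :: nat
  assumes q: "0 < cmod q" "cmod q < 1"
    and n: "n \<ge> 1"
    and conv: "cmod (z / a ^ (n - 1)) < 1"
    and a_nz: "a ^ (n - 1) \<noteq> 0"
    and b_nz: "b \<noteq> 0"
    and x_nz: "\<And>s. s \<in> {1..n} \<Longrightarrow> x s \<noteq> 0"
    and vandermonde_nz: "\<And>r s. 1 \<le> r \<Longrightarrow> r < s \<Longrightarrow> s \<le> n \<Longrightarrow> 1 - x r / x s \<noteq> 0"
    and qx_nz: "\<And>r s k. r \<in> {1..n} \<Longrightarrow> s \<in> {1..n} \<Longrightarrow> qpoch q (q * x r / x s) k \<noteq> 0"
    and b_poch_nz: "\<And>k. qpoch q b k \<noteq> 0"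
    and z_poch_nz: "\<And>k. qpoch q (z / a ^ (n - 1)) (k + 1) \<noteq> 0"
  defines "lhs \<equiv> (\<lambda>j :: nat \<Rightarrow> nat.
      (\<Prod>s=1..n. \<Prod>r\<in>{1..<s}.
          (1 - q powi (int (j r) - int (j s)) * x r / x s) / (1 - x r / x s))
    * (\<Prod>r=1..n. \<Prod>s=1..n. qpoch q (a * x r / x s) (j r) / qpoch q (q * x r / x s) (j r))
    * (qpoch q q (weight n j) / qpoch q b (weight n j))
    * (z / a ^ (n - 1)) ^ weight n j
    * q ^ (\<Sum>r=1..n. (r - 1) * j r))"
  defines "rhs \<equiv> (\<lambda>k :: nat \<Rightarrow> nat.
      (\<Prod>s=1..n. \<Prod>r\<in>{1..<s}.
          (1 - q powi (int (k r) - int (k s)) * x r / x s) / (1 - x r / x s))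
    * (\<Prod>r=1..n. \<Prod>s=1..n. qpoch q (a * x r / x s) (k r) / qpoch q (q * x r / x s) (k r))
    * ((1 - a * z * q ^ (2 * weight n k))
        * (qpoch q q (weight n k) * qpoch q (a * z * q / b) (weight n k))
        / (qpoch q b (weight n k) * qpoch q (z / a ^ (n - 1)) (weight n k + 1)))
    * (b * z / a ^ (n - 1)) ^ weight n k
    * q ^ ((\<Sum>r=1..n. (r - 1) * k r) + 2 * (weight n k choose 2)))"
  shows "lhs summable_on multi_indices n \<and> rhs summable_on multi_indices n \<and>
    (\<Sum>\<^sub>\<infinity>j\<in>multi_indices n. lhs j) = (\<Sum>\<^sub>\<infinity>k\<in>multi_indices n. rhs k)"
proof -
  \<comment> \<open>The diagonal case r = s = 1 of the denominators; n \<ge> 1 supplies the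
    index.\<close>
  have qq_nz: "qpoch q q k \<noteq> 0" for k
    using qx_nz[of 1 1 k] x_nz[of 1] n by simp
  have x_neq: "x r \<noteq> x s" if "r \<in> {1..n}" "s \<in> {1..n}" "r \<noteq> s" for r s
    using that vandermonde_nz[of r s] vandermonde_nz[of s r] x_nz[of r] x_nz[of s]
    by (cases "r < s") auto
  have q_step: "q * x r / x s * q ^ i \<noteq> 1" if "r \<in> {1..n}" "s \<in> {1..n}" for r s i
    using qx_nz[OF that, of "Suc i"] by (auto simp: qpoch_Suc)
  have generic_le: "x r * q ^ (j + i) \<noteq> x s * q ^ j" if "r \<in> {1..n}" "s \<in> {1..n}" "r \<noteq> s" for r s i j
  proof (cases i)
    case 0
    with x_neq[OF that] q show ?thesis by auto
  next
    case (Suc i')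
    with q_step[OF that(1,2), of i'] x_nz[OF that(2)] q show ?thesis
      by (auto simp: power_add field_simps)
  qed
  interpret generic_nodes q x n
  proof
    show "q \<noteq> 0" using q by auto
    show "q ^ Suc i \<noteq> 1" for i
      using qq_nz[of "Suc i"] by (auto simp: qpoch_Suc)
    show "x r \<noteq> 0" if "r \<in> {1..n}" for r
      by (rule x_nz[OF that])
    show "x r * q ^ i \<noteq> x s * q ^ j" if "r \<in> {1..n}" "s \<in> {1..n}" "r \<noteq> s" for r s i j
      using generic_le[OF that, of j "i - j"] generic_le[OF that(2,1) that(3)[symmetric], of i "j - i"]
      by (cases "j \<le> i") auto
  qed
  define Z where "Z = z / a ^ (n - 1)"
  \<comment> \<open>This turns A t of the Rogers-Fine identity, with A = a^n and t =
    \<open>Z\<close>, into the a z of the statement.\<close>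
  have aZ: "a ^ n * Z = a * z"
    using a_nz n by (cases n) (auto simp: Z_def)
  have Z: "cmod Z < 1"
    using conv by (simp add: Z_def)
  have bZ: "b * z / a ^ (n - 1) = b * Z"
    by (simp add: Z_def)
  let ?w = "coef (\<lambda>_. a)"
  define c where "c N = qpoch q q N / qpoch q b N * Z ^ N" for N
  define d where "d N = (1 - a * z * q ^ (2 * N)) * (qpoch q q N * qpoch q (a * z * q / b) N) /
      (qpoch q b N * qpoch q Z (N + 1)) * (b * Z) ^ N * q ^ (2 * (N choose 2))" for N
  obtain D where D: "\<And>k. cmod (?w k) \<le> D"
    using coef_bounded[OF q(2), of "\<lambda>_. a"] by blast
  have lhs_eq: "lhs = (\<lambda>k. ?w k * c (weight n k))"
    unfolding lhs_def c_def coef_def vandermonde_node[symmetric] Z_def[symmetric] by (simp add: mult_ac)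
  have rhs_eq: "rhs = (\<lambda>k. ?w k * d (weight n k))"
    unfolding rhs_def d_def coef_def vandermonde_node[symmetric] bZ Z_def[symmetric] power_add
    by (simp add: mult_ac)
  obtain C where C: "\<And>N. cmod (qpoch q q N / qpoch q b N) \<le> C"
    using Bseq_qpoch_quotient[OF q(2) b_poch_nz, of q] unfolding Bseq_def by blast
  have "cmod (c N) \<le> C * cmod Z ^ N" for N
    unfolding c_def norm_mult[of _ "Z ^ N"] norm_power by (intro mult_right_mono C) simp
  note lhs = has_sum_multi_indices_by_weight[where w = ?w and n = n, OF norm_ge_zero Z this D, folded lhs_eq]
  \<comment> \<open>The factor 2^N is moved into the term with quadratic exponent, which stays
    bounded, in order to split off the summable (1/2)^N; |b Z| itself may exceed 1.\<close>
  have d_eq: "d N = (1 - a * z * q ^ (2 * N)) * (qpoch q q N / qpoch q b N) *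
      (qpoch q (a * z * q / b) N * inverse (qpoch q Z (Suc N))) *
      ((2 * b * Z) ^ N * q ^ (N * (N - 1))) * (1 / 2) ^ N" for N
    by (simp add: d_def double_choose_two divide_simps power_mult_distrib)
  have "Bseq (\<lambda>N. 1 - a * z * q ^ (2 * N))"
  proof (rule BseqI')
    fix N
    have "cmod (a * z * q ^ (2 * N)) \<le> cmod (a * z)"
      using q(2) by (simp add: norm_mult norm_power mult_left_le power_le_one)
    then show "cmod (1 - a * z * q ^ (2 * N)) \<le> 1 + cmod (a * z)"
      using norm_triangle_ineq4[of 1 "a * z * q ^ (2 * N)"] by simp
  qed
  moreover have "Bseq (\<lambda>N. inverse (qpoch q Z (Suc N)))"
    using Bseq_inverse_qpoch[OF q(2) qpoch_nz[OF q(2) Z]]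
    by (simp add: Bseq_Suc_iff[of "\<lambda>N. inverse (qpoch q Z N)"])
  moreover have "Bseq (\<lambda>N. (2 * b * Z) ^ N * q ^ (N * (N - 1)))"
    by (rule convergent_imp_Bseq[OF convergentI[OF square_power_tendsto_0[OF q(2)]]])
  ultimately have "Bseq (\<lambda>N. (1 - a * z * q ^ (2 * N)) * (qpoch q q N / qpoch q b N) *
      (qpoch q (a * z * q / b) N * inverse (qpoch q Z (Suc N))) * ((2 * b * Z) ^ N * q ^ (N * (N - 1))))"
    by (rule Bseq_mult[OF Bseq_mult[OF Bseq_mult[OF _ Bseq_qpoch_quotient[OF q(2) b_poch_nz]]
      Bseq_mult[OF Bseq_qpoch[OF q(2)]]]])
  then obtain C' where "\<And>N. cmod ((1 - a * z * q ^ (2 * N)) * (qpoch q q N / qpoch q b N) *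
      (qpoch q (a * z * q / b) N * inverse (qpoch q Z (Suc N))) * ((2 * b * Z) ^ N * q ^ (N * (N - 1)))) \<le> C'"
    unfolding Bseq_def by blast
  moreover have "cmod ((1 / 2) ^ N) = (1 / 2) ^ N" for N
    by (simp add: norm_power norm_divide)
  ultimately have "cmod (d N) \<le> C' * (1 / 2) ^ N" for N
    unfolding d_eq norm_mult[of _ "(1 / 2) ^ N"] by (simp add: mult_right_mono)
  note rhs = has_sum_multi_indices_by_weight[where w = ?w and n = n, OF _ _ this D, folded rhs_eq, simplified]
  have w_sum: "(\<Sum>k | k \<in> multi_indices n \<and> weight n k = N. ?w k) = qpoch q (a ^ n) N / qpoch q q N" for N
    using milne_q_binomial[of "\<lambda>_. a" N] by simp
  have "(\<lambda>N. qpoch q (a ^ n) N / qpoch q b N * Z ^ N) sums infsum lhs (multi_indices n)"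
    using lhs(2) qq_nz by (simp add: w_sum c_def)
  then have "infsum lhs (multi_indices n) = (\<Sum>N. qpoch q (a ^ n) N / qpoch q b N * Z ^ N)"
    by (rule sums_unique)
  moreover have "(\<lambda>N. qpoch q (a ^ n) N / qpoch q q N * d N) sums infsum rhs (multi_indices n)"
    using rhs(2) by (simp only: w_sum)
  \<comment> \<open>The factor (q)_N of the summand cancels the denominator from Milne's theorem and
    leaves the Rogers-Fine term.\<close>
  moreover have "qpoch q (a ^ n) N / qpoch q q N * d N =
      qpoch q (a ^ n) N * qpoch q (a ^ n * Z * q / b) N * (b * Z) ^ N * q ^ (N * (N - 1)) *
      (1 - a ^ n * Z * q ^ (2 * N)) / (qpoch q b N * qpoch q Z (Suc N))" for N
    unfolding aZ using qq_nz[of N] by (simp add: d_def double_choose_two mult_ac)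
  ultimately have "infsum lhs (multi_indices n) = infsum rhs (multi_indices n)"
    using rogers_fine[OF q(2) Z b_nz b_poch_nz, of "a ^ n"] by (simp add: sums_iff)
  then show ?thesis
    using lhs(1) rhs(1) by simp
qed

end
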